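(* Let $X$ be a countable linear order. Then $X$ is self-similar if and only if there exist $N$ (either a natural number $n \geq 1$ or $\mathbb{N}$), countable linear orders $I_k$ ($k \in N$), and a non-negligible interval $I$ of the shuffle $\mathbb{Q}[I_k]$ such that $X \cong I$.
   Context: All orders are strict linear orders; $\cong$ denotes order-isomorphism. An interval of an order is a convex subset. A convex copy of $X$ inside an order $Y$ is an interval $I\subseteq Y$ with $I\cong X$. An order $X$ is self-similar if it contains two convex copies $I,J$ of itself with $I\cap J=\emptyset$. Shuffle: let $N$ be either a natural number $n\ge 1$ (identified with $\{0,\dots,n-1\}$) or $\mathbb{N}$; partition $\mathbb{Q}=\bigcup_{k\in N}Q_k$ with each $Q_k$ dense in $\mathbb{Q}$; given orders $I_k$ ($k\in N$), put $I_q=I_k$ for $q\in Q_k$, and let $\mathbb{Q}[I_k]$ be the replacement $\mathbb{Q}(I_q)$, i.e. the set of pairs $(q,i)$ with $q\in\mathbb{Q}$, $i\in I_q$, ordered lexicographically ($(q,i)<(p,j)$ iff $q<p$, or $q=p$ and $i<j$). Up to isomorphism this does not depend on the chosen partition. An interval $I\subseteq \mathbb{Q}[I_k]$ is negligible if $I\subseteq \{q\}\times I_q$ for some $q\in\mathbb{Q}$, and non-negligible otherwise.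
   Formalization: X is assumed nonempty, since the empty order is vacuously self-similar but isomorphic only to the empty interval, which is negligible; the countable orders I_k are taken, up to isomorphism, on sets of natural numbers, and the partition of ℚ is part of the existential choice. *)

theory Defs
  imports Complex_Main "HOL-Library.Countable_Set" "HOL-Library.Disjoint_Sets"
begin

text \<open>
  A linear order is a carrier \<open>A\<close> together with a strict relation \<open>r\<close> such that
  \<open>strict_linear_order_on A r\<close>. Isomorphism is stated relative to the carriers instead of through
  the library's \<open>iso\<close>, which works on the field of a relation: the field of a strict order on a
  singleton is empty, so one-element orders would be lost.
\<close>

definition order_iso :: "'a set \<Rightarrow> 'a rel \<Rightarrow> 'b set \<Rightarrow> 'b rel \<Rightarrow> bool" where
  "order_iso A r B s \<longleftrightarrow>
     (\<exists>f. bij_betw f A B \<and> (\<forall>x\<in>A. \<forall>y\<in>A. (x, y) \<in> r \<longleftrightarrow> (f x, f y) \<in> s))"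

definition order_interval :: "'a set \<Rightarrow> 'a rel \<Rightarrow> 'a set \<Rightarrow> bool" where
  "order_interval A r J \<longleftrightarrow>
     J \<subseteq> A \<and> (\<forall>x\<in>J. \<forall>z\<in>J. \<forall>y\<in>A. (x, y) \<in> r \<and> (y, z) \<in> r \<longrightarrow> y \<in> J)"

definition convex_copy :: "'a set \<Rightarrow> 'a rel \<Rightarrow> 'b set \<Rightarrow> 'b rel \<Rightarrow> 'b set \<Rightarrow> bool" where
  "convex_copy A r B s J \<longleftrightarrow> order_interval B s J \<and> order_iso J s A r"

definition self_similar :: "'a set \<Rightarrow> 'a rel \<Rightarrow> bool" where
  "self_similar A r \<longleftrightarrow>
     (\<exists>J K. convex_copy A r A r J \<and> convex_copy A r A r K \<and> J \<inter> K = {})"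

definition replacement_carrier :: "('l \<Rightarrow> 'b set) \<Rightarrow> ('l \<times> 'b) set" where
  "replacement_carrier F = (SIGMA q:UNIV. F q)"

definition replacement_rel :: "('l::linorder \<Rightarrow> 'b set) \<Rightarrow> ('l \<Rightarrow> 'b rel) \<Rightarrow> ('l \<times> 'b) rel" where
  "replacement_rel F R =
     {((q, i), (p, j)). i \<in> F q \<and> j \<in> F p \<and> (q < p \<or> q = p \<and> (i, j) \<in> R q)}"

definition shuffle_index :: "nat set \<Rightarrow> bool" where
  "shuffle_index N \<longleftrightarrow> (\<exists>n\<ge>1. N = {..<n}) \<or> N = UNIV"

definition dense_partition :: "nat set \<Rightarrow> (nat \<Rightarrow> rat set) \<Rightarrow> bool" where
  "dense_partition N Q \<longleftrightarrow>
     (\<Union>k\<in>N. Q k) = UNIV \<and> disjoint_family_on Q N \<and>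
     (\<forall>k\<in>N. \<forall>a b. a < b \<longrightarrow> (\<exists>q\<in>Q k. a < q \<and> q < b))"

definition block_index :: "nat set \<Rightarrow> (nat \<Rightarrow> rat set) \<Rightarrow> rat \<Rightarrow> nat" where
  "block_index N Q q = (THE k. k \<in> N \<and> q \<in> Q k)"

definition shuffle_carrier ::
  "nat set \<Rightarrow> (nat \<Rightarrow> rat set) \<Rightarrow> (nat \<Rightarrow> 'b set) \<Rightarrow> (rat \<times> 'b) set" where
  "shuffle_carrier N Q I = replacement_carrier (\<lambda>q. I (block_index N Q q))"

definition shuffle_rel ::
  "nat set \<Rightarrow> (nat \<Rightarrow> rat set) \<Rightarrow> (nat \<Rightarrow> 'b set) \<Rightarrow> (nat \<Rightarrow> 'b rel) \<Rightarrow> (rat \<times> 'b) rel" where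
  "shuffle_rel N Q I R =
     replacement_rel (\<lambda>q. I (block_index N Q q)) (\<lambda>q. R (block_index N Q q))"

definition shuffle_negligible ::
  "nat set \<Rightarrow> (nat \<Rightarrow> rat set) \<Rightarrow> (nat \<Rightarrow> 'b set) \<Rightarrow> (rat \<times> 'b) set \<Rightarrow> bool" where
  "shuffle_negligible N Q I J \<longleftrightarrow> (\<exists>q. J \<subseteq> {q} \<times> I (block_index N Q q))"

text \<open>
  Existential quantification over countable linear orders can be carried out over orders on sets of
  natural numbers: every countable linear order is isomorphic to such an order, and a shuffle only
  depends on the isomorphism types of its summands.
\<close>

lemma countable_order_iso_nat:
  assumes "countable A" "strict_linear_order_on A r"
  shows "\<exists>(B::nat set) s. strict_linear_order_on B s \<and> order_iso A r B s"
proof -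
  define f where "f = to_nat_on A"
  have inj: "inj_on f A"
    using assms(1) by (simp add: f_def inj_on_to_nat_on)
  define s where "s = {(f x, f y) | x y. x \<in> A \<and> y \<in> A \<and> (x, y) \<in> r}"
  have iff: "(f x, f y) \<in> s \<longleftrightarrow> (x, y) \<in> r" if "x \<in> A" "y \<in> A" for x y
    using that inj unfolding s_def inj_on_def by blast
  have sub: "s \<subseteq> f ` A \<times> f ` A"
    unfolding s_def by blast
  have r: "trans r" "irrefl r" "total_on A r"
    using assms(2) by (auto simp: strict_linear_order_on_def)
  have "trans s"
  proof (rule transI)
    fix a b c assume h: "(a, b) \<in> s" "(b, c) \<in> s"
    then obtain x y z where xyz: "x \<in> A" "y \<in> A" "z \<in> A" "a = f x" "b = f y" "c = f z"
      using sub by blast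
    then have "(x, y) \<in> r" "(y, z) \<in> r"
      using h iff by auto
    then have "(x, z) \<in> r"
      using r(1) by (meson transD)
    then show "(a, c) \<in> s"
      using xyz iff by auto
  qed
  moreover have "irrefl s"
    unfolding irrefl_def using sub iff r(2) by (auto simp: irrefl_def)
  moreover have "total_on (f ` A) s"
    unfolding total_on_def using iff r(3) by (auto simp: total_on_def)
  moreover have "order_iso A r (f ` A) s"
    unfolding order_iso_def using inj iff by (intro exI[of _ f]) (auto simp: bij_betw_def)
  ultimately show ?thesis
    unfolding strict_linear_order_on_def by blast
qed

lemma shuffle_cong_iso:
  assumes "dense_partition N Q" "\<And>k. k \<in> N \<Longrightarrow> order_iso (I k) (R k) (I' k) (R' k)"
  shows "\<exists>h. bij_betw h (shuffle_carrier N Q I) (shuffle_carrier N Q I')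
           \<and> (\<forall>x\<in>shuffle_carrier N Q I. \<forall>y\<in>shuffle_carrier N Q I.
                (x, y) \<in> shuffle_rel N Q I R \<longleftrightarrow> (h x, h y) \<in> shuffle_rel N Q I' R')
           \<and> (\<forall>x. fst (h x) = fst x)"
proof -
  have idx: "block_index N Q q \<in> N" for q
  proof -
    have "\<exists>!k. k \<in> N \<and> q \<in> Q k"
      using assms(1) unfolding dense_partition_def disjoint_family_on_def by blast
    from theI'[OF this] show ?thesis
      unfolding block_index_def by blast
  qed
  obtain f where f: "\<And>k. k \<in> N \<Longrightarrow> bij_betw (f k) (I k) (I' k)"
    "\<And>k x y. k \<in> N \<Longrightarrow> x \<in> I k \<Longrightarrow> y \<in> I k \<Longrightarrow> (x, y) \<in> R k \<longleftrightarrow> (f k x, f k y) \<in> R' k"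
    using assms(2) unfolding order_iso_def by metis
  define h where "h = (\<lambda>(q, i). (q, f (block_index N Q q) i))"
  have mem: "f (block_index N Q q) i \<in> I' (block_index N Q q)"
    if "i \<in> I (block_index N Q q)" for q i
    using f(1)[OF idx] that by (auto dest: bij_betwE)
  have "inj_on h (shuffle_carrier N Q I)"
    using f(1)[OF idx]
    by (auto simp: inj_on_def h_def shuffle_carrier_def replacement_carrier_def bij_betw_def)
  moreover have "h ` shuffle_carrier N Q I = shuffle_carrier N Q I'"
  proof (intro equalityI subsetI)
    fix z assume "z \<in> h ` shuffle_carrier N Q I"
    then show "z \<in> shuffle_carrier N Q I'"
      using mem by (auto simp: h_def shuffle_carrier_def replacement_carrier_def)
  next
    fix z assume "z \<in> shuffle_carrier N Q I'"
    then obtain q j where z: "z = (q, j)" "j \<in> I' (block_index N Q q)"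
      by (auto simp: shuffle_carrier_def replacement_carrier_def)
    then obtain i where "i \<in> I (block_index N Q q)" "j = f (block_index N Q q) i"
      using f(1)[OF idx, of q] by (auto simp: bij_betw_def)
    then show "z \<in> h ` shuffle_carrier N Q I"
      using z by (intro image_eqI[of _ _ "(q, i)"])
        (auto simp: h_def shuffle_carrier_def replacement_carrier_def)
  qed
  moreover have "\<forall>x\<in>shuffle_carrier N Q I. \<forall>y\<in>shuffle_carrier N Q I.
      (x, y) \<in> shuffle_rel N Q I R \<longleftrightarrow> (h x, h y) \<in> shuffle_rel N Q I' R'"
    using mem f(2)[OF idx]
    by (auto simp: h_def shuffle_carrier_def replacement_carrier_def shuffle_rel_def
        replacement_rel_def)
  moreover have "\<forall>x. fst (h x) = fst x"
    by (auto simp: h_def)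
  ultimately show ?thesis
    unfolding bij_betw_def by blast
qed

end

theory Submission
  imports Defs
begin

text \<open>
  Let \<open>J\<close> be a non-negligible interval of a shuffle. A back-and-forth argument embeds the convex
  hull of the set of blocks met by \<open>J\<close> into any open interval of rationals as a convex set, keeping
  the index of every block (an endpoint goes to a point with the same index). Doing this in two
  disjoint intervals whose blocks lie in \<open>J\<close> gives two disjoint convex copies of \<open>J\<close>.

  Conversely, call \<open>x < y\<close> separated if a convex copy of the self-similar order \<open>X\<close> lies strictly
  between them. Non-separation is a convex equivalence relation. Its classes are densely ordered,
  and since each copy of \<open>X\<close> reproduces every inner class (one that is neither first nor last), so
  are the inner classes of any given order type. By Cantor's theorem the union of the inner classes
  is a shuffle, and it contains a convex copy of \<open>X\<close>.
\<close>

section \<open>Order isomorphisms\<close>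

lemma order_iso_sym: "order_iso A r B s \<Longrightarrow> order_iso B s A r"
proof -
  assume "order_iso A r B s"
  then obtain f where f: "bij_betw f A B" "\<And>x y. x \<in> A \<Longrightarrow> y \<in> A \<Longrightarrow> (x, y) \<in> r \<longleftrightarrow> (f x, f y) \<in> s"
    unfolding order_iso_def by blast
  have "(x, y) \<in> s \<longleftrightarrow> (inv_into A f x, inv_into A f y) \<in> r" if "x \<in> B" "y \<in> B" for x y
    using f(2)[of "inv_into A f x" "inv_into A f y"] that f(1)
    by (simp add: bij_betw_inv_into_right bij_betwE[OF bij_betw_inv_into[OF f(1)]])
  then show ?thesis
    unfolding order_iso_def using bij_betw_inv_into[OF f(1)] by blast
qed

lemma order_iso_trans:
  assumes "order_iso A r B s" "order_iso B s C t"
  shows "order_iso A r C t"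
proof -
  obtain f where f: "bij_betw f A B" "\<And>x y. x \<in> A \<Longrightarrow> y \<in> A \<Longrightarrow> (x, y) \<in> r \<longleftrightarrow> (f x, f y) \<in> s"
    using assms(1) unfolding order_iso_def by blast
  obtain g where g: "bij_betw g B C" "\<And>x y. x \<in> B \<Longrightarrow> y \<in> B \<Longrightarrow> (x, y) \<in> s \<longleftrightarrow> (g x, g y) \<in> t"
    using assms(2) unfolding order_iso_def by blast
  have "\<forall>x\<in>A. \<forall>y\<in>A. (x, y) \<in> r \<longleftrightarrow> ((g \<circ> f) x, (g \<circ> f) y) \<in> t"
    using f g(2) by (auto dest: bij_betwE)
  then show ?thesis
    unfolding order_iso_def using bij_betw_trans[OF f(1) g(1)] by blast
qed

lemma order_iso_image:
  assumes "inj_on f A" "\<And>x y. x \<in> A \<Longrightarrow> y \<in> A \<Longrightarrow> (x, y) \<in> r \<longleftrightarrow> (f x, f y) \<in> s"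
  shows "order_iso A r (f ` A) s"
  unfolding order_iso_def using assms by (intro exI[of _ f]) (auto simp: bij_betw_def)

lemma order_iso_refl: "order_iso A r A r"
  using order_iso_image[of id A r r] by simp

lemma order_interval_subset:
  "order_interval A r J \<Longrightarrow> J \<subseteq> B \<Longrightarrow> B \<subseteq> A \<Longrightarrow> order_interval B r J"
  unfolding order_interval_def by blast

lemma order_interval_trans:
  assumes "order_interval A r B" "order_interval B r C"
  shows "order_interval A r C"
  using assms unfolding order_interval_def by (meson subset_iff)

lemma order_interval_image:
  assumes f: "bij_betw f A B" "\<And>x y. x \<in> A \<Longrightarrow> y \<in> A \<Longrightarrow> (x, y) \<in> r \<longleftrightarrow> (f x, f y) \<in> s"
    and J: "order_interval A r J"
  shows "order_interval B s (f ` J)"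
  unfolding order_interval_def
proof (intro conjI ballI impI)
  show "f ` J \<subseteq> B"
    using J f(1) by (auto simp: order_interval_def bij_betw_def)
next
  fix u w v assume h: "u \<in> f ` J" "w \<in> f ` J" "v \<in> B" "(u, v) \<in> s \<and> (v, w) \<in> s"
  then obtain x z y where xyz: "u = f x" "w = f z" "v = f y" "x \<in> J" "z \<in> J" "y \<in> A"
    using f(1) by (auto simp: bij_betw_def)
  moreover have "J \<subseteq> A"
    using J by (simp add: order_interval_def)
  ultimately have "(x, y) \<in> r" "(y, z) \<in> r"
    using f(2) h(4) by auto
  then show "v \<in> f ` J"
    using J xyz unfolding order_interval_def by blast
qed

lemma self_similar_iso:
  assumes iso: "order_iso A r B s" and sim: "self_similar A r"
  shows "self_similar B s"
proof -
  obtain f where f: "bij_betw f A B" "\<And>x y. x \<in> A \<Longrightarrow> y \<in> A \<Longrightarrow> (x, y) \<in> r \<longleftrightarrow> (f x, f y) \<in> s"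
    using iso unfolding order_iso_def by blast
  have inj: "inj_on f A"
    using f(1) by (simp add: bij_betw_def)
  have copy: "convex_copy B s B s (f ` J)" if J: "convex_copy A r A r J" for J
  proof -
    have JA: "J \<subseteq> A"
      using J by (simp add: convex_copy_def order_interval_def)
    have "order_iso J r (f ` J) s"
      using JA f(2) by (intro order_iso_image inj_on_subset[OF inj]) auto
    then have "order_iso (f ` J) s B s"
      using J iso order_iso_sym order_iso_trans unfolding convex_copy_def by metis
    then show ?thesis
      using J order_interval_image[of f A B r s J] f by (simp add: convex_copy_def)
  qed
  obtain J K where "convex_copy A r A r J" "convex_copy A r A r K" "J \<inter> K = {}"
    using sim unfolding self_similar_def by blast
  moreover from this have "f ` J \<inter> f ` K = {}"
    using inj unfolding convex_copy_def order_interval_def inj_on_def by blast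
  ultimately show ?thesis
    unfolding self_similar_def using copy by blast
qed

section \<open>Cantor's theorem for coloured orders\<close>

text \<open>Density is asked only of the colours that occur, so no palette has to be named. A
  constant colouring gives the dense orders without endpoints, and \<open>block_index\<close> gives
  the rationals split into dense blocks; both instances are used below.\<close>

definition colour_dense :: "'a set \<Rightarrow> 'a rel \<Rightarrow> ('a \<Rightarrow> 'c) \<Rightarrow> bool" where
  "colour_dense A r c \<longleftrightarrow> strict_linear_order_on A r \<and> (\<forall>k\<in>c ` A.
     (\<forall>x\<in>A. \<exists>w\<in>A. c w = k \<and> (w, x) \<in> r) \<and>
     (\<forall>x\<in>A. \<exists>w\<in>A. c w = k \<and> (x, w) \<in> r) \<and>
     (\<forall>x\<in>A. \<forall>y\<in>A. (x, y) \<in> r \<longrightarrow> (\<exists>w\<in>A. c w = k \<and> (x, w) \<in> r \<and> (w, y) \<in> r)))"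

lemma finite_greatest:
  assumes "finite L" "L \<noteq> {}" "L \<subseteq> A" "trans r" "total_on A r"
  shows "\<exists>m\<in>L. \<forall>x\<in>L. x = m \<or> (x, m) \<in> r"
  using assms(1-3)
proof (induction rule: finite_ne_induct)
  case (singleton x)
  then show ?case by simp
next
  case (insert x F)
  then obtain m where m: "m \<in> F" "\<forall>y\<in>F. y = m \<or> (y, m) \<in> r"
    by auto
  show ?case
  proof (cases "(m, x) \<in> r")
    case True
    then have "\<forall>y\<in>insert x F. y = x \<or> (y, x) \<in> r"
      using m assms(4) by (metis insertE transD)
    then show ?thesis by blast
  next
    case False
    then have "x = m \<or> (x, m) \<in> r"
      using m insert.prems assms(5) by (auto simp: total_on_def)
    then show ?thesis using m by auto
  qed
qed

text \<open>By transitivity it suffices to fit \<open>w\<close> between the greatest element of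
  \<open>L\<close> and the least element of \<open>U\<close>. If one of the sets is empty, the
  absence of endpoints takes over; if both are, any point of colour \<open>k\<close> serves.\<close>

lemma colour_dense_between:
  assumes cd: "colour_dense B s d" and fin: "finite L" "finite U" and sub: "L \<subseteq> B" "U \<subseteq> B"
    and less: "\<And>x y. x \<in> L \<Longrightarrow> y \<in> U \<Longrightarrow> (x, y) \<in> s" and k: "k \<in> d ` B"
  shows "\<exists>w\<in>B. d w = k \<and> (\<forall>x\<in>L. (x, w) \<in> s) \<and> (\<forall>y\<in>U. (w, y) \<in> s)"
proof -
  have s: "trans s" "total_on B s"
    using cd by (auto simp: colour_dense_def strict_linear_order_on_def)
  have L: "\<exists>m\<in>L. \<forall>x\<in>L. x = m \<or> (x, m) \<in> s" if "L \<noteq> {}"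
    using finite_greatest[OF fin(1) that sub(1) s] .
  \<comment> \<open>The least element of \<open>U\<close> is its greatest one for the converse
    relation.\<close>
  have U: "\<exists>m\<in>U. \<forall>x\<in>U. x = m \<or> (m, x) \<in> s" if "U \<noteq> {}"
    using finite_greatest[OF fin(2) that sub(2), of "s\<inverse>"] s by simp
  consider "L = {}" "U = {}" | "L = {}" "U \<noteq> {}" | "L \<noteq> {}" "U = {}" | "L \<noteq> {}" "U \<noteq> {}"
    by blast
  then show ?thesis
  proof cases
    case 1
    then show ?thesis using k by auto
  next
    case 2
    then obtain m where m: "m \<in> U" "\<forall>x\<in>U. x = m \<or> (m, x) \<in> s" using U by blast
    obtain w where "w \<in> B" "d w = k" "(w, m) \<in> s"
      using cd k m(1) sub(2) unfolding colour_dense_def by (meson subsetD)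
    then show ?thesis using 2 m s(1) by (metis empty_iff transD)
  next
    case 3
    then obtain m where m: "m \<in> L" "\<forall>x\<in>L. x = m \<or> (x, m) \<in> s" using L by blast
    obtain w where "w \<in> B" "d w = k" "(m, w) \<in> s"
      using cd k m(1) sub(1) unfolding colour_dense_def by (meson subsetD)
    then show ?thesis using 3 m s(1) by (metis empty_iff transD)
  next
    case 4
    then obtain m m' where m: "m \<in> L" "\<forall>x\<in>L. x = m \<or> (x, m) \<in> s"
      "m' \<in> U" "\<forall>x\<in>U. x = m' \<or> (m', x) \<in> s" using L U by metis
    obtain w where "w \<in> B" "d w = k" "(m, w) \<in> s" "(w, m') \<in> s"
      using cd k m(1,3) sub less[OF m(1,3)] unfolding colour_dense_def by (meson subsetD)
    then show ?thesis using m s(1) by (metis transD)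
  qed
qed

section \<open>Back-and-forth for colour-preserving partial isomorphisms\<close>

definition partial_iso ::
  "'a rel \<Rightarrow> ('a \<Rightarrow> 'c) \<Rightarrow> 'b rel \<Rightarrow> ('b \<Rightarrow> 'c) \<Rightarrow> ('a \<times> 'b) set \<Rightarrow> bool" where
  "partial_iso r c s d P \<longleftrightarrow> (\<forall>a b a' b'. (a, b) \<in> P \<longrightarrow> (a', b') \<in> P \<longrightarrow>
     ((a, a') \<in> r \<longleftrightarrow> (b, b') \<in> s) \<and> (a = a' \<longleftrightarrow> b = b') \<and> c a = d b)"

text \<open>A partial map is kept as a set of pairs, so exchanging the two orders amounts to taking
  the converse. This turns the back step into an instance of the forth step.\<close>

lemma partial_iso_converse: "partial_iso s d r c (P\<inverse>) \<longleftrightarrow> partial_iso r c s d P"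
  unfolding partial_iso_def by auto

text \<open>As \<open>P\<close> preserves the order, the partners of points below \<open>a\<close>
  precede the partners of points above \<open>a\<close>, and the density of the colour
  \<open>c a\<close> in \<open>B\<close> leaves room for a partner of \<open>a\<close> between
  them.\<close>

lemma partial_iso_extend:
  assumes A: "strict_linear_order_on A r" and cd: "colour_dense B s d"
    and P: "finite P" "P \<subseteq> A \<times> B" "partial_iso r c s d P"
    and a: "a \<in> A" "c a \<in> d ` B"
  shows "\<exists>b\<in>B. partial_iso r c s d (insert (a, b) P)"
proof (cases "a \<in> Domain P")
  case True
  then obtain b where b: "(a, b) \<in> P" by blast
  then have "insert (a, b) P = P" "b \<in> B" using P(2) by auto
  then show ?thesis using P(3) by metis
next
  case False
  have r: "trans r" "irrefl r" "total_on A r"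
    using A by (auto simp: strict_linear_order_on_def)
  have s: "trans s" "irrefl s" "total_on B s"
    using cd by (auto simp: colour_dense_def strict_linear_order_on_def)
  define L where "L = {b. \<exists>a'. (a', b) \<in> P \<and> (a', a) \<in> r}"
  define U where "U = {b. \<exists>a'. (a', b) \<in> P \<and> (a, a') \<in> r}"
  have "L \<subseteq> snd ` P" "U \<subseteq> snd ` P"
    unfolding L_def U_def by force+
  then have fin: "finite L" "finite U"
    using P(1) finite_subset by blast+
  have sub: "L \<subseteq> B" "U \<subseteq> B"
    using P(2) by (auto simp: L_def U_def)
  have "(x, y) \<in> s" if xy: "x \<in> L" "y \<in> U" for x y
  proof -
    obtain x' y' where h: "(x', x) \<in> P" "(x', a) \<in> r" "(y', y) \<in> P" "(a, y') \<in> r"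
      using xy by (auto simp: L_def U_def)
    then have "(x', y') \<in> r" using r(1) by (meson transD)
    then show ?thesis using P(3) h unfolding partial_iso_def by blast
  qed
  from colour_dense_between[OF cd fin sub this a(2)]
  obtain b where b: "b \<in> B" "d b = c a" "\<And>x. x \<in> L \<Longrightarrow> (x, b) \<in> s" "\<And>x. x \<in> U \<Longrightarrow> (b, x) \<in> s"
    by blast
  have new: "((a, a') \<in> r \<longleftrightarrow> (b, b') \<in> s) \<and> ((a', a) \<in> r \<longleftrightarrow> (b', b) \<in> s) \<and> a \<noteq> a' \<and> b \<noteq> b'
      \<and> c a' = d b'" if p: "(a', b') \<in> P" for a' b'
  proof -
    have ne: "a \<noteq> a'" using p False by blast
    have col: "c a' = d b'" using P(3) p unfolding partial_iso_def by blast
    have "a' \<in> A" using p P(2) by blast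
    then consider "(a, a') \<in> r" | "(a', a) \<in> r"
      using ne a(1) r(3) by (auto simp: total_on_def)
    then show ?thesis
    proof cases
      case 1
      then have "(b, b') \<in> s" using b(4) p by (auto simp: U_def)
      moreover have "(b', b) \<notin> s" using calculation s by (meson irreflD transD)
      moreover have "(a', a) \<notin> r" using 1 r by (meson irreflD transD)
      ultimately show ?thesis using 1 ne col s(2) by (auto simp: irrefl_def)
    next
      case 2
      then have "(b', b) \<in> s" using b(3) p by (auto simp: L_def)
      moreover have "(b, b') \<notin> s" using calculation s by (meson irreflD transD)
      moreover have "(a, a') \<notin> r" using 2 r by (meson irreflD transD)
      ultimately show ?thesis using 2 ne col s(2) by (auto simp: irrefl_def)
    qed
  qed
  have "(a, a) \<notin> r" "(b, b) \<notin> s" using r(2) s(2) by (auto simp: irrefl_def)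
  then have "partial_iso r c s d (insert (a, b) P)"
    using P(3) new b(2) unfolding partial_iso_def by (auto; blast)
  then show ?thesis using b(1) by blast
qed

lemma partial_iso_extend_both:
  assumes A: "colour_dense A r c" and B: "colour_dense B s d" and col: "c ` A = d ` B"
    and P: "finite P" "P \<subseteq> A \<times> B" "partial_iso r c s d P"
    and ab: "a \<in> A" "b \<in> B"
  shows "\<exists>P'. finite P' \<and> P' \<subseteq> A \<times> B \<and> partial_iso r c s d P' \<and> P \<subseteq> P'
    \<and> a \<in> Domain P' \<and> b \<in> Range P'"
proof -
  have lin: "strict_linear_order_on A r" "strict_linear_order_on B s"
    using A B by (auto simp: colour_dense_def)
  obtain b' where b': "b' \<in> B" "partial_iso r c s d (insert (a, b') P)"
    using partial_iso_extend[OF lin(1) B P ab(1)] ab(1) col by auto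
  define P1 where "P1 = insert (a, b') P"
  have P1: "finite (P1\<inverse>)" "P1\<inverse> \<subseteq> B \<times> A" "partial_iso s d r c (P1\<inverse>)"
    using P b' ab unfolding P1_def by (auto simp only: partial_iso_converse finite_converse finite_insert)
  obtain a' where a': "a' \<in> A" "partial_iso s d r c (insert (b, a') (P1\<inverse>))"
    using partial_iso_extend[OF lin(2) A P1 ab(2)] ab(2) col by auto
  have "(insert (a', b) P1)\<inverse> = insert (b, a') (P1\<inverse>)" by auto
  then have "partial_iso r c s d (insert (a', b) P1)"
    using a'(2) partial_iso_converse by metis
  then show ?thesis
    using P b' a' ab unfolding P1_def
    by (intro exI[of _ "insert (a', b) (insert (a, b') P)"]) auto
qed

text \<open>Stage \<open>n\<close> puts the \<open>n\<close>-th element of each enumeration into a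
  finite partial isomorphism. The condition in \<open>partial_iso\<close> concerns two pairs at a
  time, and any two pairs of the increasing union lie in a common stage, so the union is the graph
  of an isomorphism.\<close>

theorem colour_dense_iso:
  assumes A: "colour_dense A r c" "countable A" "A \<noteq> {}"
    and B: "colour_dense B s d" "countable B" and col: "c ` A = d ` B"
  shows "\<exists>f. bij_betw f A B \<and> (\<forall>x\<in>A. \<forall>y\<in>A. (x, y) \<in> r \<longleftrightarrow> (f x, f y) \<in> s) \<and> (\<forall>x\<in>A. d (f x) = c x)"
proof -
  have Bne: "B \<noteq> {}" using A(3) col by auto
  let ?a = "from_nat_into A" and ?b = "from_nat_into B"
  have "\<exists>P. \<forall>n. (finite (P n) \<and> P n \<subseteq> A \<times> B \<and> partial_iso r c s d (P n)) \<and>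
      (P n \<subseteq> P (Suc n) \<and> ?a n \<in> Domain (P (Suc n)) \<and> ?b n \<in> Range (P (Suc n)))"
  proof (rule dependent_nat_choice)
    show "\<exists>P. finite P \<and> P \<subseteq> A \<times> B \<and> partial_iso r c s d P"
      by (rule exI[of _ "{}"]) (simp add: partial_iso_def)
  next
    fix P n assume "finite P \<and> P \<subseteq> A \<times> B \<and> partial_iso r c s d P"
    then show "\<exists>P'. (finite P' \<and> P' \<subseteq> A \<times> B \<and> partial_iso r c s d P') \<and>
        (P \<subseteq> P' \<and> ?a n \<in> Domain P' \<and> ?b n \<in> Range P')"
      using partial_iso_extend_both[OF A(1) B(1) col, of P "?a n" "?b n"]
        from_nat_into[OF A(3)] from_nat_into[OF Bne] by blast
  qed
  then obtain P where P: "\<And>n. P n \<subseteq> A \<times> B" "\<And>n. partial_iso r c s d (P n)"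
    "\<And>n. P n \<subseteq> P (Suc n)" "\<And>n. ?a n \<in> Domain (P (Suc n))" "\<And>n. ?b n \<in> Range (P (Suc n))"
    by blast
  define G where "G = (\<Union>n. P n)"
  have mono: "P m \<subseteq> P n" if "m \<le> n" for m n
    using lift_Suc_mono_le[of P, OF P(3) that] .
  have G: "partial_iso r c s d G"
    unfolding partial_iso_def
  proof (intro allI impI)
    fix a b a' b' assume "(a, b) \<in> G" "(a', b') \<in> G"
    then obtain m n where "(a, b) \<in> P m" "(a', b') \<in> P n" by (auto simp: G_def)
    then have "(a, b) \<in> P (max m n)" "(a', b') \<in> P (max m n)"
      using mono[of m "max m n"] mono[of n "max m n"] by auto
    then show "((a, a') \<in> r \<longleftrightarrow> (b, b') \<in> s) \<and> (a = a' \<longleftrightarrow> b = b') \<and> c a = d b"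
      using P(2)[of "max m n"] unfolding partial_iso_def by blast
  qed
  have sub: "G \<subseteq> A \<times> B" using P(1) by (auto simp: G_def)
  have dom: "\<exists>b. (a, b) \<in> G" if "a \<in> A" for a
    using P(4)[of "to_nat_on A a"] A(2) that by (auto simp: G_def)
  have ran: "\<exists>a. (a, b) \<in> G" if "b \<in> B" for b
    using P(5)[of "to_nat_on B b"] B(2) that by (auto simp: G_def)
  obtain f where f: "\<And>a. a \<in> A \<Longrightarrow> (a, f a) \<in> G"
    using dom by metis
  have "inj_on f A"
    using f G unfolding partial_iso_def inj_on_def by metis
  moreover have "f ` A = B"
  proof (intro equalityI subsetI)
    fix b assume "b \<in> B"
    then obtain a where "(a, b) \<in> G" using ran by blast
    moreover from this have "a \<in> A" using sub by blast
    ultimately show "b \<in> f ` A"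
      using f[of a] G unfolding partial_iso_def by (metis imageI)
  qed (use f sub in auto)
  moreover have "\<forall>x\<in>A. \<forall>y\<in>A. (x, y) \<in> r \<longleftrightarrow> (f x, f y) \<in> s"
    using f G unfolding partial_iso_def by blast
  moreover have "\<forall>x\<in>A. d (f x) = c x"
    using f G unfolding partial_iso_def by metis
  ultimately show ?thesis
    unfolding bij_betw_def by blast
qed

section \<open>Intervals of shuffles are self-similar\<close>

lemma block_index_eq:
  assumes "dense_partition N Q" "k \<in> N" "q \<in> Q k"
  shows "block_index N Q q = k"
  unfolding block_index_def
  using assms unfolding dense_partition_def disjoint_family_on_def by (intro the_equality) blast+

lemma block_index_between:
  assumes "dense_partition N Q" "a < b"
  shows "\<exists>q. a < q \<and> q < b \<and> block_index N Q q = block_index N Q p"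
proof -
  have "p \<in> (\<Union>k\<in>N. Q k)"
    using assms(1) by (simp add: dense_partition_def)
  then obtain k where k: "k \<in> N" "p \<in> Q k" by blast
  obtain q where "q \<in> Q k" "a < q" "q < b"
    using assms k(1) unfolding dense_partition_def by blast
  then show ?thesis using block_index_eq[OF assms(1) k(1)] k(2) by blast
qed

text \<open>Between any two points of \<open>H\<close> there are points of every index, and
  convexity puts them into \<open>H\<close>. All such sets therefore show the same colours, as
  \<open>colour_dense_iso\<close> demands of the two orders it compares.\<close>

lemma colour_dense_rat:
  assumes Q: "dense_partition N Q"
    and H: "H \<noteq> {}" "\<forall>x\<in>H. \<exists>a\<in>H. a < x" "\<forall>x\<in>H. \<exists>b\<in>H. x < b"
      "\<forall>x\<in>H. \<forall>z\<in>H. {x<..<z} \<subseteq> H"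
  shows "colour_dense H {(x, y). x < y} (block_index N Q)"
    and "block_index N Q ` H = range (block_index N Q)"
proof -
  have bet: "\<exists>w\<in>H. block_index N Q w = block_index N Q p \<and> x < w \<and> w < y"
    if "x \<in> H" "y \<in> H" "x < y" for x y p
    using block_index_between[OF Q that(3), of p] H(4) that by (meson greaterThanLessThan_iff subset_iff)
  have "strict_linear_order_on H {(x, y). x < y}"
    by (auto simp: strict_linear_order_on_def trans_def irrefl_def total_on_def)
  then show "colour_dense H {(x, y). x < y} (block_index N Q)"
    unfolding colour_dense_def
  proof (intro conjI ballI impI)
    fix k x assume k: "k \<in> block_index N Q ` H" and x: "x \<in> H"
    obtain p where p: "k = block_index N Q p" using k by blast
    obtain a b where ab: "a \<in> H" "a < x" "b \<in> H" "x < b" using H(2,3) x by blast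
    show "\<exists>w\<in>H. block_index N Q w = k \<and> (w, x) \<in> {(x, y). x < y}"
      using bet[OF ab(1) x ab(2), of p] p by auto
    show "\<exists>w\<in>H. block_index N Q w = k \<and> (x, w) \<in> {(x, y). x < y}"
      using bet[OF x ab(3,4), of p] p by auto
    fix y assume "y \<in> H" "(x, y) \<in> {(x, y). x < y}"
    then show "\<exists>w\<in>H. block_index N Q w = k \<and> (x, w) \<in> {(x, y). x < y} \<and> (w, y) \<in> {(x, y). x < y}"
      using bet[OF x, of y p] p by auto
  qed
  show "block_index N Q ` H = range (block_index N Q)"
  proof (intro equalityI subsetI)
    fix k assume "k \<in> range (block_index N Q)"
    then obtain p where p: "k = block_index N Q p" by blast
    obtain x y where "x \<in> H" "y \<in> H" "x < y" using H(1,3) by blast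
    then obtain w where "w \<in> H" "block_index N Q w = k" using bet[of x y p] p by auto
    then show "k \<in> block_index N Q ` H" by blast
  qed auto
qed

text \<open>Without its endpoints, \<open>H\<close> is a convex set to which the coloured form of
  Cantor's theorem applies, with an open interval from \<open>a\<close> to \<open>b\<close> as its
  target. The endpoints that exist are then sent to \<open>a\<close> or \<open>b\<close>, which have
  been chosen with the right index.\<close>

lemma convex_rat_embed:
  assumes Q: "dense_partition N Q" and uv: "u < v"
    and H: "\<forall>x\<in>H. \<forall>z\<in>H. {x<..<z} \<subseteq> H"
    and two: "h1 \<in> H" "h2 \<in> H" "h1 < h2"
  obtains g where "strict_mono_on H g" "\<And>x. x \<in> H \<Longrightarrow> block_index N Q (g x) = block_index N Q x"
    "g ` H \<subseteq> {u<..<v}" "\<And>x y z. x \<in> H \<Longrightarrow> z \<in> H \<Longrightarrow> g x < y \<Longrightarrow> y < g z \<Longrightarrow> y \<in> g ` H"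
proof -
  let ?c = "block_index N Q"
  \<comment> \<open>The midpoint keeps \<open>a\<close> to the left of \<open>b\<close> although the
    two are chosen independently.\<close>
  define m where "m = (u + v) / 2"
  have m: "u < m" "m < v" using uv by (auto simp: m_def)
  \<comment> \<open>If \<open>H\<close> has a least point, \<open>a\<close> takes over its index;
    otherwise the condition on the index is vacuous.\<close>
  have "\<exists>a. u < a \<and> a < m \<and> (\<forall>x\<in>H. (\<forall>y\<in>H. x \<le> y) \<longrightarrow> ?c a = ?c x)"
  proof (cases "\<exists>x\<in>H. \<forall>y\<in>H. x \<le> y")
    case True
    then obtain x where x: "x \<in> H" "\<forall>y\<in>H. x \<le> y" by blast
    then have "x' = x" if "x' \<in> H" "\<forall>y\<in>H. x' \<le> y" for x' using that by force
    then show ?thesis using block_index_between[OF Q m(1), of x] by metis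
  qed (use dense[OF m(1)] in blast)
  then obtain a where a: "u < a" "a < m" "\<And>x. x \<in> H \<Longrightarrow> \<forall>y\<in>H. x \<le> y \<Longrightarrow> ?c a = ?c x"
    by blast
  have "\<exists>b. m < b \<and> b < v \<and> (\<forall>x\<in>H. (\<forall>y\<in>H. y \<le> x) \<longrightarrow> ?c b = ?c x)"
  proof (cases "\<exists>x\<in>H. \<forall>y\<in>H. y \<le> x")
    case True
    then obtain x where x: "x \<in> H" "\<forall>y\<in>H. y \<le> x" by blast
    then have "x' = x" if "x' \<in> H" "\<forall>y\<in>H. y \<le> x'" for x' using that by force
    then show ?thesis using block_index_between[OF Q m(2), of x] by metis
  qed (use dense[OF m(2)] in blast)
  then obtain b where b: "m < b" "b < v" "\<And>x. x \<in> H \<Longrightarrow> \<forall>y\<in>H. y \<le> x \<Longrightarrow> ?c b = ?c x"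
    by blast
  have ab: "a < b" using a b by simp
  define H0 where "H0 = {x \<in> H. (\<exists>y\<in>H. y < x) \<and> (\<exists>y\<in>H. x < y)}"
  have H0_iff: "x \<in> H0 \<longleftrightarrow> (\<exists>y\<in>H. y < x) \<and> (\<exists>y\<in>H. x < y)" for x
    using H unfolding H0_def by (auto simp: subset_iff)
  have up: "\<forall>x\<in>H0. \<exists>b\<in>H0. x < b"
  proof
    fix x assume x: "x \<in> H0"
    obtain y where y: "y \<in> H" "x < y" using x H0_iff by blast
    obtain w where "x < w" "w < y" using dense[OF y(2)] by blast
    then show "\<exists>b\<in>H0. x < b" using x y H0_iff[of w] H0_iff[of x] less_trans by blast
  qed
  have down: "\<forall>x\<in>H0. \<exists>b\<in>H0. b < x"
  proof
    fix x assume x: "x \<in> H0"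
    obtain y where y: "y \<in> H" "y < x" using x H0_iff by blast
    obtain w where "y < w" "w < x" using dense[OF y(2)] by blast
    then show "\<exists>b\<in>H0. b < x" using x y H0_iff[of w] H0_iff[of x] less_trans by blast
  qed
  obtain w where "h1 < w" "w < h2" using dense[OF two(3)] by blast
  then have ne: "H0 \<noteq> {}" using two H0_iff by blast
  have conv: "\<forall>x\<in>H0. \<forall>z\<in>H0. {x<..<z} \<subseteq> H0"
    using H0_iff by (meson greaterThanLessThan_iff less_trans subsetI)
  note cd0 = colour_dense_rat[OF Q ne down up conv]
  have "\<exists>f. bij_betw f H0 {a<..<b} \<and> (\<forall>x\<in>H0. \<forall>y\<in>H0. (x, y) \<in> {(x, y). x < y} \<longleftrightarrow>
      (f x, f y) \<in> {(x, y). x < y}) \<and> (\<forall>x\<in>H0. ?c (f x) = ?c x)"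
  proof -
    have ne1: "{a<..<b} \<noteq> {}" using ab by simp
    have lo: "\<forall>x\<in>{a<..<b}. \<exists>y\<in>{a<..<b}. y < x"
    proof
      fix x assume "x \<in> {a<..<b}"
      then show "\<exists>y\<in>{a<..<b}. y < x" using dense[of a x] by force
    qed
    have hi: "\<forall>x\<in>{a<..<b}. \<exists>y\<in>{a<..<b}. x < y"
    proof
      fix x assume "x \<in> {a<..<b}"
      then show "\<exists>y\<in>{a<..<b}. x < y" using dense[of x b] by force
    qed
    have cv: "\<forall>x\<in>{a<..<b}. \<forall>z\<in>{a<..<b}. {x<..<z} \<subseteq> {a<..<b}"
      by auto
    note cd1 = colour_dense_rat[OF Q ne1 lo hi cv]
    show ?thesis
      using colour_dense_iso[OF cd0(1) _ ne cd1(1)] cd0(2) cd1(2) by simp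
  qed
  then obtain f where f: "bij_betw f H0 {a<..<b}" "\<And>x y. x \<in> H0 \<Longrightarrow> y \<in> H0 \<Longrightarrow> x < y \<Longrightarrow> f x < f y"
    "\<And>x. x \<in> H0 \<Longrightarrow> ?c (f x) = ?c x"
    by auto
  \<comment> \<open>On \<open>H\<close>, the values \<open>a\<close> and \<open>b\<close> are taken
    only at a least and at a greatest point.\<close>
  define g where "g x = (if \<exists>y\<in>H. y < x then if \<exists>y\<in>H. x < y then f x else b else a)" for x
  have g0: "g x = f x" if "x \<in> H0" for x
    using that by (auto simp: g_def H0_iff)
  have fab: "a < f x" "f x < b" if "x \<in> H0" for x
    using f(1) that by (auto dest: bij_betwE)
  show thesis
  proof (rule that[of g])
    show "strict_mono_on H g"
    proof (rule strict_mono_onI)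
      fix x y assume xy: "x \<in> H" "y \<in> H" "x < y"
      then have gx: "g x = (if x \<in> H0 then f x else a)" "g y = (if y \<in> H0 then f y else b)"
        by (auto simp: g_def H0_iff)
      show "g x < g y"
        using f(2)[of x y] fab[of x] fab[of y] xy ab by (auto simp: gx)
    qed
    show "?c (g x) = ?c x" if x: "x \<in> H" for x
      using a(3)[OF x] b(3)[OF x] f(3)[of x] x by (auto simp: g_def H0_iff not_less)
    have gab: "a \<le> g x \<and> g x \<le> b" if x: "x \<in> H" for x
    proof (cases "x \<in> H0")
      case True
      then show ?thesis using fab[of x] g0 by simp
    next
      case False
      then have "g x = a \<or> g x = b" by (auto simp: g_def H0_iff)
      then show ?thesis using ab by auto
    qed
    then show "g ` H \<subseteq> {u<..<v}"
      using a(1) b(2) by force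
    fix x y z assume xyz: "x \<in> H" "z \<in> H" "g x < y" "y < g z"
    then have "y \<in> {a<..<b}"
      using gab[of x] gab[of z] by auto
    then obtain t where "t \<in> H0" "y = f t"
      using f(1) unfolding bij_betw_def by blast
    then have "t \<in> H" "y = g t"
      using g0 by (auto simp: H0_def)
    then show "y \<in> g ` H" by blast
  qed
qed

lemma shuffle_mem: "(q, i) \<in> shuffle_carrier N Q I \<longleftrightarrow> i \<in> I (block_index N Q q)"
  by (simp add: shuffle_carrier_def replacement_carrier_def)

lemma shuffle_less: "((q, i), (p, j)) \<in> shuffle_rel N Q I R \<longleftrightarrow>
    i \<in> I (block_index N Q q) \<and> j \<in> I (block_index N Q p) \<and>
    (q < p \<or> q = p \<and> (i, j) \<in> R (block_index N Q q))"
  by (simp add: shuffle_rel_def replacement_rel_def)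

text \<open>Blocks are moved as a whole along an embedding \<open>g\<close> of their positions into
  the interval from \<open>u\<close> to \<open>v\<close>. As \<open>g\<close> keeps the index,
  source and target blocks carry the same order and the second coordinate can stay unchanged. Since
  \<open>u\<close> and \<open>v\<close> lie between two blocks met by \<open>J\<close>, the image
  falls back into \<open>J\<close>.\<close>

lemma shuffle_interval_copy:
  fixes I :: "nat \<Rightarrow> 'b set" and J :: "(rat \<times> 'b) set"
  assumes Q: "dense_partition N Q"
    and J: "order_interval (shuffle_carrier N Q I) (shuffle_rel N Q I R) J"
    and q: "q1 \<in> fst ` J" "q2 \<in> fst ` J" "q1 \<le> u" "u < v" "v \<le> q2"
  shows "\<exists>K. convex_copy J (shuffle_rel N Q I R) J (shuffle_rel N Q I R) K \<and> fst ` K \<subseteq> {u<..<v}"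
proof -
  let ?S = "shuffle_carrier N Q I" and ?r = "shuffle_rel N Q I R" and ?c = "block_index N Q"
  have JS: "J \<subseteq> ?S" using J by (simp add: order_interval_def)
  \<comment> \<open>The convex hull is taken because summands may be empty, so the positions of the
    blocks met by \<open>J\<close> need not form a convex set.\<close>
  define H where "H = {q. \<exists>a\<in>fst ` J. \<exists>b\<in>fst ` J. a \<le> q \<and> q \<le> b}"
  have JH: "fst x \<in> H" if "x \<in> J" for x
    using that unfolding H_def by blast
  have conv: "\<forall>x\<in>H. \<forall>z\<in>H. {x<..<z} \<subseteq> H"
  proof (intro ballI subsetI)
    fix x z y assume xz: "x \<in> H" "z \<in> H" and y: "y \<in> {x<..<z}"
    obtain a b where "a \<in> fst ` J" "a \<le> x" "b \<in> fst ` J" "z \<le> b"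
      using xz unfolding H_def by blast
    then show "y \<in> H"
      unfolding H_def using y by (intro CollectI bexI[of _ a] bexI[of _ b]) auto
  qed
  have two: "q1 \<in> H" "q2 \<in> H" "q1 < q2"
    using q JH by auto
  obtain g where g: "strict_mono_on H g" "\<And>x. x \<in> H \<Longrightarrow> ?c (g x) = ?c x" "g ` H \<subseteq> {u<..<v}"
    "\<And>x y z. x \<in> H \<Longrightarrow> z \<in> H \<Longrightarrow> g x < y \<Longrightarrow> y < g z \<Longrightarrow> y \<in> g ` H"
    using convex_rat_embed[OF Q q(4) conv two] by blast
  define F :: "rat \<times> 'b \<Rightarrow> rat \<times> 'b" where "F = (\<lambda>(q, i). (g q, i))"
  have gless: "g x < g y \<longleftrightarrow> x < y" and geq: "g x = g y \<longleftrightarrow> x = y" if "x \<in> H" "y \<in> H" for x y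
    using g(1) that by (auto simp: strict_mono_on_less strict_mono_on_eqD)
  have Fless: "(x, y) \<in> ?r \<longleftrightarrow> (F x, F y) \<in> ?r" if "fst x \<in> H" "fst y \<in> H" for x y
    using that g(2) gless geq by (cases x; cases y) (auto simp: F_def shuffle_less)
  have inj: "inj_on F J"
    using geq JH by (fastforce simp: inj_on_def F_def)
  have FS: "F x \<in> ?S" if "x \<in> J" for x
    using that JS JH[OF that] g(2) by (cases x) (auto simp: F_def shuffle_mem)
  have int: "order_interval ?S ?r (F ` J)"
    unfolding order_interval_def
  proof (intro conjI ballI impI)
    fix x z y assume xzy: "x \<in> F ` J" "z \<in> F ` J" "y \<in> ?S" "(x, y) \<in> ?r \<and> (y, z) \<in> ?r"
    obtain x' z' where xz: "x = F x'" "z = F z'" "x' \<in> J" "z' \<in> J" using xzy by blast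
    obtain p j where y: "y = (p, j)" by fastforce
    have "g (fst x') \<le> p" "p \<le> g (fst z')"
      using xzy(4) xz y by (cases x'; cases z'; auto simp: F_def shuffle_less)+
    \<comment> \<open>If \<open>p\<close> equals one of its two bounds, it is a value of
      \<open>g\<close> already; otherwise the convexity of the image of \<open>g\<close>
      applies.\<close>
    then have "p \<in> g ` H"
      using g(4)[of "fst x'" "fst z'" p] JH[OF xz(3)] JH[OF xz(4)] by (auto simp: order_le_less)
    then obtain q where q: "q \<in> H" "p = g q" by blast
    then have Fy: "F (q, j) = y" by (simp add: F_def y)
    have mem: "(q, j) \<in> ?S" using xzy(3) y q g(2) by (simp add: shuffle_mem)
    have "(x', (q, j)) \<in> ?r" "((q, j), z') \<in> ?r"
      using xzy(4) xz Fy Fless JH q(1) by (metis fst_conv)+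
    then have "(q, j) \<in> J" using J mem xz unfolding order_interval_def by blast
    then show "y \<in> F ` J" using Fy by blast
  qed (use FS in blast)
  have fstF: "fst ` F ` J \<subseteq> {u<..<v}"
    using g(3) JH by (force simp: F_def)
  have sub: "F ` J \<subseteq> J"
  proof
    fix y assume y: "y \<in> F ` J"
    then have "fst y \<in> {u<..<v}" using fstF by blast
    moreover obtain x z where xz: "x \<in> J" "z \<in> J" "fst x = q1" "fst z = q2" using q by blast
    moreover have "y \<in> ?S" using y FS by blast
    ultimately have "(x, y) \<in> ?r" "(y, z) \<in> ?r"
      using q JS by (cases x; cases y; cases z; auto simp: shuffle_less shuffle_mem)+
    then show "y \<in> J" using J xz \<open>y \<in> ?S\<close> unfolding order_interval_def by blast
  qed
  have "order_iso J ?r (F ` J) ?r"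
    using inj Fless JH by (intro order_iso_image) auto
  then have "convex_copy J ?r J ?r (F ` J)"
    using order_interval_subset[OF int sub JS] order_iso_sym unfolding convex_copy_def by blast
  then show ?thesis using fstF by blast
qed

text \<open>A non-negligible interval meets two different blocks. Cutting the range between them at
  \<open>m\<close> and embedding \<open>J\<close> into each half gives copies that are disjoint
  because they use different blocks.\<close>

lemma shuffle_interval_self_similar:
  assumes Q: "dense_partition N Q"
    and J: "order_interval (shuffle_carrier N Q I) (shuffle_rel N Q I R) J"
    and neg: "\<not> shuffle_negligible N Q I J"
  shows "self_similar J (shuffle_rel N Q I R)"
proof -
  let ?r = "shuffle_rel N Q I R"
  have sub: "x \<in> J \<Longrightarrow> snd x \<in> I (block_index N Q (fst x))" for x
    using J shuffle_mem[of "fst x" "snd x"] by (auto simp: order_interval_def)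
  \<comment> \<open>The empty set is negligible.\<close>
  obtain x where x: "x \<in> J"
    using neg unfolding shuffle_negligible_def by blast
  obtain y where y: "y \<in> J" "fst y \<noteq> fst x"
    using neg sub unfolding shuffle_negligible_def
    by (metis mem_Times_iff prod.collapse singletonI subsetI)
  obtain q1 q2 where q: "q1 \<in> fst ` J" "q2 \<in> fst ` J" "q1 < q2"
    using x y by (metis imageI linorder_neqE)
  obtain m where m: "q1 < m" "m < q2"
    using dense[OF q(3)] by blast
  obtain K1 K2 where "convex_copy J ?r J ?r K1" "fst ` K1 \<subseteq> {q1<..<m}"
    "convex_copy J ?r J ?r K2" "fst ` K2 \<subseteq> {m<..<q2}"
    using shuffle_interval_copy[OF Q J q(1,2), of q1 m] shuffle_interval_copy[OF Q J q(1,2), of m q2] m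
    by auto
  moreover from this have "K1 \<inter> K2 = {}" by force
  ultimately show ?thesis unfolding self_similar_def by blast
qed


text \<open>Numbering the values of \<open>t\<close> yields one of the two shapes allowed for the
  index set of a shuffle: an initial segment if there are finitely many values, nonempty because
  \<open>A\<close> is, and all natural numbers otherwise. It will number the isomorphism types of
  the inner classes.\<close>

lemma countable_colouring:
  assumes "countable A" "A \<noteq> {}"
  obtains N col where "shuffle_index N" "col ` A = N"
    "\<And>x y. x \<in> A \<Longrightarrow> y \<in> A \<Longrightarrow> col x = col y \<longleftrightarrow> t x = t y"
proof -
  have "\<exists>e N. bij_betw e (t ` A) N \<and> shuffle_index N"
  proof (cases "finite (t ` A)")
    case True
    have "card (t ` A) \<ge> 1"
      using True assms(2) by (simp add: Suc_leI card_gt_0_iff)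
    then have "shuffle_index {..<card (t ` A)}"
      unfolding shuffle_index_def by blast
    moreover have "\<exists>e. bij_betw e (t ` A) {..<card (t ` A)}"
      using True by (simp add: finite_same_card_bij)
    ultimately show ?thesis by blast
  next
    case False
    have "bij_betw (to_nat_on (t ` A)) (t ` A) UNIV"
      using to_nat_on_infinite[OF countable_image[OF assms(1)] False] .
    then show ?thesis unfolding shuffle_index_def by blast
  qed
  then obtain e N where e: "bij_betw e (t ` A) N" "shuffle_index N" by blast
  show thesis
  proof (rule that[of N "e \<circ> t"])
    show "(e \<circ> t) ` A = N"
      using e(1) by (simp add: bij_betw_def image_comp)
    show "(e \<circ> t) x = (e \<circ> t) y \<longleftrightarrow> t x = t y" if "x \<in> A" "y \<in> A" for x y
      using e(1) that by (auto simp: bij_betw_def inj_on_def)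
  qed (rule e(2))
qed

section \<open>Self-similar orders are intervals of shuffles\<close>

locale self_similar_order =
  fixes X :: "'a set" and r :: "'a rel"
  assumes linear: "strict_linear_order_on X r" and nonempty: "X \<noteq> {}" and similar: "self_similar X r"
begin

abbreviation copy :: "'a set \<Rightarrow> bool" where
  "copy \<equiv> convex_copy X r X r"

text \<open>Membership in \<open>X\<close> is explicit because \<open>r\<close> may also relate
  points outside its carrier.\<close>

definition sep :: "'a \<Rightarrow> 'a \<Rightarrow> bool" where
  "sep x y \<longleftrightarrow> x \<in> X \<and> y \<in> X \<and> (\<exists>C. copy C \<and> (\<forall>c\<in>C. (x, c) \<in> r \<and> (c, y) \<in> r))"

definition cls :: "'a \<Rightarrow> 'a set" where
  "cls x = {y \<in> X. \<not> sep x y \<and> \<not> sep y x}"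

definition inner :: "'a set" where
  "inner = {x. \<exists>a b. sep a x \<and> sep x b}"

lemma less_trans: "(x, y) \<in> r \<Longrightarrow> (y, z) \<in> r \<Longrightarrow> (x, z) \<in> r"
  using linear by (auto simp: strict_linear_order_on_def dest: transD)

lemma less_irrefl: "(x, x) \<notin> r"
  using linear by (auto simp: strict_linear_order_on_def irrefl_def)

lemma less_total: "x \<in> X \<Longrightarrow> y \<in> X \<Longrightarrow> x \<noteq> y \<Longrightarrow> (x, y) \<in> r \<or> (y, x) \<in> r"
  using linear by (auto simp: strict_linear_order_on_def total_on_def)

section \<open>Convex copies of the order in itself\<close>

lemma copy_subset: "copy C \<Longrightarrow> C \<subseteq> X"
  by (simp add: convex_copy_def order_interval_def)

lemma copy_nonempty: "copy C \<Longrightarrow> C \<noteq> {}"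
  using nonempty by (auto simp: convex_copy_def order_iso_def bij_betw_def)

lemma copy_self: "copy X"
  by (auto simp: convex_copy_def order_interval_def order_iso_refl)

lemma copy_convex:
  assumes "copy C" "x \<in> C" "z \<in> C" "y \<in> X" "(x, y) \<in> r" "(y, z) \<in> r"
  shows "y \<in> C"
  using assms unfolding convex_copy_def order_interval_def by blast

lemma copy_iso:
  assumes "copy Y"
  obtains f where "bij_betw f X Y" "\<And>x y. x \<in> X \<Longrightarrow> y \<in> X \<Longrightarrow> (x, y) \<in> r \<longleftrightarrow> (f x, f y) \<in> r"
  using order_iso_sym[of Y r X r] assms unfolding convex_copy_def order_iso_def by blast

text \<open>Intervals of \<open>Y\<close> are intervals of \<open>X\<close> because \<open>Y\<close>
  is convex. Both directions matter: copies are pushed forward into \<open>Y\<close>, and copies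
  found inside \<open>Y\<close> are pulled back.\<close>

lemma copy_image:
  assumes Y: "copy Y" and f: "bij_betw f X Y" "\<And>x y. x \<in> X \<Longrightarrow> y \<in> X \<Longrightarrow> (x, y) \<in> r \<longleftrightarrow> (f x, f y) \<in> r"
    and C: "C \<subseteq> X"
  shows "copy (f ` C) \<longleftrightarrow> copy C"
proof -
  have inj: "inj_on f X" and img: "f ` X = Y"
    using f(1) by (auto simp: bij_betw_def)
  have iso: "order_iso C r (f ` C) r"
    using C f(2) by (intro order_iso_image inj_on_subset[OF inj]) auto
  have "order_interval X r (f ` C) \<longleftrightarrow> order_interval X r C"
  proof
    assume "order_interval X r C"
    then have "order_interval Y r (f ` C)"
      using order_interval_image[of f X Y r r] f by blast
    then show "order_interval X r (f ` C)"
      using Y order_interval_trans unfolding convex_copy_def by blast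
  next
    assume int: "order_interval X r (f ` C)"
    show "order_interval X r C"
      unfolding order_interval_def
    proof (intro conjI ballI impI)
      fix x z y assume h: "x \<in> C" "z \<in> C" "y \<in> X" "(x, y) \<in> r \<and> (y, z) \<in> r"
      then have "(f x, f y) \<in> r" "(f y, f z) \<in> r" using C f(2) by auto
      moreover have "f y \<in> X" using h(3) img copy_subset[OF Y] by blast
      ultimately have "f y \<in> f ` C" using int h unfolding order_interval_def by blast
      then show "y \<in> C" using inj h(3) C by (simp add: inj_on_image_mem_iff)
    qed (rule C)
  qed
  then show ?thesis
    unfolding convex_copy_def using iso order_iso_sym order_iso_trans by metis
qed

text \<open>Self-similarity provides two disjoint copies in \<open>X\<close>, and an isomorphism
  from \<open>X\<close> onto \<open>C\<close> carries them into \<open>C\<close>. Of two disjoint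
  nonempty convex sets, one lies entirely below the other, so they can be named in increasing
  order.\<close>

lemma copy_split:
  assumes "copy C"
  obtains C1 C2 where "copy C1" "copy C2" "C1 \<subseteq> C" "C2 \<subseteq> C" "\<And>x y. x \<in> C1 \<Longrightarrow> y \<in> C2 \<Longrightarrow> (x, y) \<in> r"
proof -
  obtain J K where JK: "copy J" "copy K" "J \<inter> K = {}"
    using similar unfolding self_similar_def by blast
  obtain f where f: "bij_betw f X C" "\<And>x y. x \<in> X \<Longrightarrow> y \<in> X \<Longrightarrow> (x, y) \<in> r \<longleftrightarrow> (f x, f y) \<in> r"
    using copy_iso[OF assms] by blast
  note sub = copy_subset[OF JK(1)] copy_subset[OF JK(2)]
  define J' K' where "J' = f ` J" and "K' = f ` K"
  have c: "copy J'" "copy K'"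
    unfolding J'_def K'_def using copy_image[OF assms f] JK sub by auto
  have s: "J' \<subseteq> C" "K' \<subseteq> C"
    unfolding J'_def K'_def using f(1) sub by (auto simp: bij_betw_def)
  have d: "J' \<inter> K' = {}"
    unfolding J'_def K'_def using f(1) sub JK(3) unfolding bij_betw_def inj_on_def by blast
  obtain a b where ab: "a \<in> J'" "b \<in> K'"
    using c copy_nonempty by blast
  \<comment> \<open>A point of \<open>A\<close> above \<open>b\<close> would force \<open>b\<close>
    into \<open>A\<close> by convexity, so all of \<open>A\<close> is below \<open>b\<close>; a
    point of \<open>B\<close> below some \<open>x\<close> in \<open>A\<close> would then force
    \<open>x\<close> into \<open>B\<close>.\<close>
  have ordered: "\<forall>x\<in>A. \<forall>y\<in>B. (x, y) \<in> r"
    if AB: "copy A" "copy B" "A \<inter> B = {}" "a \<in> A" "b \<in> B" "(a, b) \<in> r" for A B a b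
  proof (intro ballI)
    fix x y assume x: "x \<in> A" and y: "y \<in> B"
    have X: "x \<in> X" "y \<in> X" "a \<in> X" "b \<in> X"
      using AB x y copy_subset by blast+
    have xb: "(x, b) \<in> r"
      using copy_convex[OF AB(1) AB(4) x X(4) AB(6)] less_total[OF X(1,4)] AB(3,5) x by blast
    show "(x, y) \<in> r"
      using copy_convex[OF AB(2) y AB(5) X(1) _ xb] less_total[OF X(1,2)] AB(3) x y by blast
  qed
  have "a \<in> X" "b \<in> X" "a \<noteq> b"
    using ab c copy_subset d by blast+
  then consider "(a, b) \<in> r" | "(b, a) \<in> r"
    using less_total by blast
  then show thesis
  proof cases
    case 1
    then show thesis using ordered[OF c d ab] that[OF c s] by blast
  next
    case 2
    have d': "K' \<inter> J' = {}" using d by blast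
    show thesis using ordered[OF c(2,1) d' ab(2,1) 2] that[OF c(2,1) s(2,1)] by blast
  qed
qed

section \<open>Separation as a strict weak order\<close>

lemma sep_less: "sep x y \<Longrightarrow> (x, y) \<in> r"
  unfolding sep_def using copy_nonempty less_trans by blast

lemma sep_mem: "sep x y \<Longrightarrow> x \<in> X" "sep x y \<Longrightarrow> y \<in> X"
  by (auto simp: sep_def)

lemma sep_less_trans: "sep x y \<Longrightarrow> (y, z) \<in> r \<Longrightarrow> z \<in> X \<Longrightarrow> sep x z"
  unfolding sep_def using less_trans by blast

lemma less_sep_trans: "x \<in> X \<Longrightarrow> (x, y) \<in> r \<Longrightarrow> sep y z \<Longrightarrow> sep x z"
  unfolding sep_def using less_trans by blast

lemma sep_trans: "sep x y \<Longrightarrow> sep y z \<Longrightarrow> sep x z"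
  using sep_less_trans sep_less sep_mem by blast

lemma sep_irrefl: "\<not> sep x x"
  using sep_less less_irrefl by blast

text \<open>
  Self-similarity makes \<open>sep\<close> a strict weak order: of two ordered copies inside the one that
  separates \<open>x\<close> from \<open>z\<close>, at least one lies on one side of \<open>y\<close>.
\<close>

lemma sep_cotrans:
  assumes "sep x z" "y \<in> X"
  shows "sep x y \<or> sep y z"
proof -
  obtain C where C: "copy C" "\<forall>c\<in>C. (x, c) \<in> r \<and> (c, z) \<in> r"
    using assms(1) unfolding sep_def by blast
  obtain C1 C2 where C12: "copy C1" "copy C2" "C1 \<subseteq> C" "C2 \<subseteq> C"
    "\<And>x y. x \<in> C1 \<Longrightarrow> y \<in> C2 \<Longrightarrow> (x, y) \<in> r"
    using copy_split[OF C(1)] by blast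
  note mem = sep_mem[OF assms(1)]
  show ?thesis
  proof (cases "\<forall>c\<in>C1. (c, y) \<in> r")
    case True
    then have "sep x y" unfolding sep_def using mem assms(2) C C12 by blast
    then show ?thesis ..
  next
    case False
    then obtain c where c: "c \<in> C1" "(c, y) \<notin> r" by blast
    then have "c = y \<or> (y, c) \<in> r" using less_total copy_subset[OF C12(1)] assms(2) by blast
    then have "\<forall>c'\<in>C2. (y, c') \<in> r" using C12(5) c(1) less_trans by blast
    then have "sep y z" unfolding sep_def using mem assms(2) C C12 by blast
    then show ?thesis ..
  qed
qed

text \<open>Repeated splitting produces copies \<open>A1\<close> < \<open>A3\<close> <
  \<open>Y\<close> < \<open>B1\<close> < \<open>B2\<close> inside \<open>C\<close>. With
  \<open>a\<close> in \<open>A1\<close> and \<open>b\<close> in \<open>B2\<close>, the copies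
  \<open>A3\<close> and \<open>B1\<close> separate \<open>Y\<close> from \<open>a\<close> and from
  \<open>b\<close>.\<close>

lemma copy_middle:
  assumes "copy C"
  obtains Y a b where "copy Y" "Y \<subseteq> C" "a \<in> C" "b \<in> C" "\<And>y. y \<in> Y \<Longrightarrow> sep a y \<and> sep y b"
proof -
  obtain A B where AB: "copy A" "copy B" "A \<subseteq> C" "B \<subseteq> C" "\<And>x y. x \<in> A \<Longrightarrow> y \<in> B \<Longrightarrow> (x, y) \<in> r"
    using copy_split[OF assms] by blast
  obtain A1 A2 where A: "copy A1" "copy A2" "A1 \<subseteq> A" "A2 \<subseteq> A"
    "\<And>x y. x \<in> A1 \<Longrightarrow> y \<in> A2 \<Longrightarrow> (x, y) \<in> r"
    using copy_split[OF AB(1)] by blast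
  obtain A3 Y where Y: "copy A3" "copy Y" "A3 \<subseteq> A2" "Y \<subseteq> A2"
    "\<And>x y. x \<in> A3 \<Longrightarrow> y \<in> Y \<Longrightarrow> (x, y) \<in> r"
    using copy_split[OF A(2)] by blast
  obtain B1 B2 where B: "copy B1" "copy B2" "B1 \<subseteq> B" "B2 \<subseteq> B"
    "\<And>x y. x \<in> B1 \<Longrightarrow> y \<in> B2 \<Longrightarrow> (x, y) \<in> r"
    using copy_split[OF AB(2)] by blast
  obtain a b where ab: "a \<in> A1" "b \<in> B2"
    using copy_nonempty A(1) B(2) by blast
  have "sep a y \<and> sep y b" if y: "y \<in> Y" for y
  proof
    have mem: "a \<in> X" "y \<in> X" "b \<in> X"
      using ab y copy_subset A(1) B(2) Y(2) by blast+
    have "\<forall>c\<in>A3. (a, c) \<in> r \<and> (c, y) \<in> r"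
      using A(5) Y(3,5) ab(1) y by blast
    then show "sep a y" unfolding sep_def using mem Y(1) by blast
    have "\<forall>c\<in>B1. (y, c) \<in> r \<and> (c, b) \<in> r"
      using AB(5) A(4) B(3,5) Y(4) ab(2) y by blast
    then show "sep y b" unfolding sep_def using mem B(1) by blast
  qed
  moreover have "Y \<subseteq> C" "a \<in> C" "b \<in> C"
    using ab A B AB Y by blast+
  ultimately show thesis using that Y(2) by blast
qed

text \<open>A copy lying between two points of \<open>Y\<close> is contained in \<open>Y\<close> by
  convexity, hence is the image of a copy in \<open>X\<close>. So separation measured in
  \<open>X\<close> agrees with separation measured inside \<open>Y\<close>.\<close>

lemma sep_image:
  assumes Y: "copy Y" and f: "bij_betw f X Y" "\<And>x y. x \<in> X \<Longrightarrow> y \<in> X \<Longrightarrow> (x, y) \<in> r \<longleftrightarrow> (f x, f y) \<in> r"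
    and uv: "u \<in> X" "v \<in> X"
  shows "sep (f u) (f v) \<longleftrightarrow> sep u v"
proof
  have fX: "f x \<in> Y" "f x \<in> X" if "x \<in> X" for x
    using that f(1) copy_subset[OF Y] by (auto dest: bij_betwE)
  {
    assume "sep u v"
    then obtain C where C: "copy C" "\<forall>c\<in>C. (u, c) \<in> r \<and> (c, v) \<in> r"
      unfolding sep_def by blast
    have CX: "C \<subseteq> X" using copy_subset[OF C(1)] .
    have "copy (f ` C)" using copy_image[OF Y f CX] C(1) by blast
    moreover have "\<forall>c\<in>f ` C. (f u, c) \<in> r \<and> (c, f v) \<in> r" using C(2) f(2) uv CX by blast
    ultimately show "sep (f u) (f v)" unfolding sep_def using fX uv by blast
  next
    assume "sep (f u) (f v)"
    then obtain C where C: "copy C" "\<forall>c\<in>C. (f u, c) \<in> r \<and> (c, f v) \<in> r"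
      unfolding sep_def by blast
    have "C \<subseteq> Y"
      using C copy_convex[OF Y fX(1)[OF uv(1)] fX(1)[OF uv(2)]] copy_subset[OF C(1)] by blast
    then obtain D where D: "D \<subseteq> X" "C = f ` D"
      using f(1) unfolding bij_betw_def by (metis subset_imageE)
    have "copy D" using copy_image[OF Y f D(1)] C(1) D(2) by blast
    moreover have "\<forall>c\<in>D. (u, c) \<in> r \<and> (c, v) \<in> r" using C(2) f(2) uv D by blast
    ultimately show "sep u v" unfolding sep_def using uv by blast
  }
qed

section \<open>Classes of non-separated points\<close>

lemma cls_self: "x \<in> X \<Longrightarrow> x \<in> cls x"
  by (simp add: cls_def sep_irrefl)

lemma cls_subset: "cls x \<subseteq> X"
  by (auto simp: cls_def)

text \<open>Two uses of \<open>sep_cotrans\<close> replace first \<open>x\<close> and then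
  \<open>y\<close> by another member of its class, so \<open>sep\<close> induces an order on the
  classes.\<close>

lemma sep_cls:
  assumes "sep x y" "x' \<in> cls x" "y' \<in> cls y"
  shows "sep x' y'"
  using assms sep_cotrans[of x y x'] sep_cotrans[of x' y y'] unfolding cls_def by blast

text \<open>By \<open>sep_cotrans\<close>, two points not separated from each other are separated
  from the same points on the same side; this is the transitivity of non-separation.\<close>

lemma cls_eq_iff:
  assumes "x \<in> X" "y \<in> X"
  shows "cls x = cls y \<longleftrightarrow> \<not> sep x y \<and> \<not> sep y x"
proof
  assume "cls x = cls y"
  then show "\<not> sep x y \<and> \<not> sep y x" using cls_self[OF assms(1)] cls_def by blast
next
  assume h: "\<not> sep x y \<and> \<not> sep y x"
  have "sep x z \<longleftrightarrow> sep y z" "sep z x \<longleftrightarrow> sep z y" if "z \<in> X" for z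
    using h assms that sep_cotrans by blast+
  then show "cls x = cls y" by (auto simp: cls_def)
qed

lemma inner_subset: "inner \<subseteq> X"
  using sep_mem by (auto simp: inner_def)

lemma cls_inner:
  assumes "x \<in> inner"
  shows "cls x \<subseteq> inner"
proof
  fix y assume y: "y \<in> cls x"
  obtain a b where "sep a x" "sep x b" using assms by (auto simp: inner_def)
  then have "sep a y" "sep y b"
    using sep_cls y cls_self sep_mem by blast+
  then show "y \<in> inner" by (auto simp: inner_def)
qed

text \<open>The copy that separates \<open>x\<close> from \<open>z\<close> contains a smaller copy
  \<open>Y\<close> separated from both. An isomorphism \<open>f\<close> from \<open>X\<close> onto
  \<open>Y\<close> preserves and reflects \<open>sep\<close>, so it carries the class of
  \<open>w\<close> onto the class of \<open>f w\<close>, which is the required one.\<close>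

lemma inner_dense:
  assumes w: "w \<in> inner" and xz: "sep x z"
  obtains y where "y \<in> inner" "sep x y" "sep y z" "order_iso (cls w) r (cls y) r"
proof -
  obtain C where C: "copy C" "\<forall>c\<in>C. (x, c) \<in> r \<and> (c, z) \<in> r"
    using xz unfolding sep_def by blast
  obtain Y a b where Y: "copy Y" "Y \<subseteq> C" "a \<in> C" "b \<in> C" "\<And>y. y \<in> Y \<Longrightarrow> sep a y \<and> sep y b"
    using copy_middle[OF C(1)] by blast
  obtain f where f: "bij_betw f X Y" "\<And>x y. x \<in> X \<Longrightarrow> y \<in> X \<Longrightarrow> (x, y) \<in> r \<longleftrightarrow> (f x, f y) \<in> r"
    using copy_iso[OF Y(1)] by blast
  have wX: "w \<in> X" using w inner_subset by blast
  have fX: "f x \<in> Y" "f x \<in> X" if "x \<in> X" for x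
    using that f(1) copy_subset[OF Y(1)] by (auto dest: bij_betwE)
  have sepf: "sep (f u) (f v) \<longleftrightarrow> sep u v" if "u \<in> X" "v \<in> X" for u v
    using sep_image[OF Y(1) f that] .
  have x: "sep x (f w)"
    using Y(5)[OF fX(1)[OF wX]] C(2) Y(3) less_sep_trans sep_mem(1)[OF xz] by blast
  have z: "sep (f w) z"
    using Y(5)[OF fX(1)[OF wX]] C(2) Y(4) sep_less_trans sep_mem(2)[OF xz] by blast
  have "f ` cls w = cls (f w)"
  proof (intro equalityI subsetI)
    fix t assume t: "t \<in> cls (f w)"
    \<comment> \<open>Here it matters that \<open>w\<close> is inner: the images of \<open>p\<close>
      and \<open>q\<close> enclose the whole class of \<open>f w\<close>, which therefore cannot
      reach outside \<open>Y\<close>.\<close>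
    obtain p q where pq: "sep p w" "sep w q" using w by (auto simp: inner_def)
    note pX = sep_mem(1)[OF pq(1)] and qX = sep_mem(2)[OF pq(2)]
    have "sep (f p) (f w)" "sep (f w) (f q)"
      using pq sepf pX qX wX by auto
    then have "sep (f p) t" "sep t (f q)"
      using sep_cls t cls_self fX(2) pX qX by auto
    then have "t \<in> Y"
      using copy_convex[OF Y(1) fX(1)[OF pX] fX(1)[OF qX]] sep_mem(1) sep_less by auto
    then obtain s where "s \<in> X" "t = f s" using f(1) by (auto simp: bij_betw_def)
    then show "t \<in> f ` cls w" using t sepf wX by (auto simp: cls_def)
  qed (use sepf wX fX(2) in \<open>auto simp: cls_def\<close>)
  moreover have "order_iso (cls w) r (f ` cls w) r"
    using f cls_subset[of w]
    by (intro order_iso_image) (auto simp: bij_betw_def subset_iff intro: inj_on_subset)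
  ultimately show thesis
    using that[of "f w"] x z by (auto simp: inner_def)
qed

text \<open>The classes of inner points, ordered by \<open>sep\<close>, form a copy of the
  rationals. Grouping the rationals by the isomorphism type of the class at each position gives the
  partition, and the types themselves give the summands. The last conjunct will serve to show that
  an interval is not negligible.\<close>

lemma inner_iso_shuffle:
  assumes "countable X"
  shows "\<exists>N Q (I :: nat \<Rightarrow> nat set) R h. shuffle_index N \<and> dense_partition N Q \<and>
    (\<forall>k\<in>N. strict_linear_order_on (I k) (R k)) \<and> bij_betw h inner (shuffle_carrier N Q I) \<and>
    (\<forall>x\<in>inner. \<forall>y\<in>inner. (x, y) \<in> r \<longleftrightarrow> (h x, h y) \<in> shuffle_rel N Q I R) \<and>
    (\<forall>x\<in>inner. \<forall>y\<in>inner. sep x y \<longrightarrow> fst (h x) \<noteq> fst (h y))"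
proof -
  define A where "A = cls ` inner"
  define s where "s = {(cls x, cls y) | x y. x \<in> inner \<and> y \<in> inner \<and> sep x y}"
  have X: "x \<in> X" if "x \<in> inner" for x
    using that inner_subset by blast
  have s_iff: "(cls x, cls y) \<in> s \<longleftrightarrow> sep x y" if xy: "x \<in> inner" "y \<in> inner" for x y
  proof
    assume "(cls x, cls y) \<in> s"
    then obtain x' y' where h: "cls x = cls x'" "cls y = cls y'" "sep x' y'"
      by (auto simp: s_def)
    then show "sep x y" using sep_cls[OF h(3), of x y] cls_self X xy by auto
  qed (use xy in \<open>auto simp: s_def\<close>)
  have lin: "strict_linear_order_on A s"
    unfolding strict_linear_order_on_def
  proof (intro conjI)
    show "trans s"
    proof (rule transI)
      fix a b c assume "(a, b) \<in> s" "(b, c) \<in> s"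
      moreover from this obtain x y z where
        "x \<in> inner" "y \<in> inner" "z \<in> inner" "a = cls x" "b = cls y" "c = cls z"
        by (auto simp: s_def)
      ultimately show "(a, c) \<in> s" using s_iff sep_trans by blast
    qed
    show "irrefl s"
      using cls_eq_iff X by (auto simp: irrefl_def s_def)
    show "total_on A s"
      using s_iff cls_eq_iff X by (auto simp: total_on_def A_def)
  qed
  obtain Y a b where Y: "copy Y" "\<And>y. y \<in> Y \<Longrightarrow> sep a y \<and> sep y b"
    using copy_middle[OF copy_self] by metis
  obtain y where "y \<in> Y"
    using copy_nonempty[OF Y(1)] by blast
  then have "y \<in> inner" using Y(2) by (auto simp: inner_def)
  then have ne: "A \<noteq> {}" by (auto simp: A_def)
  have cnt: "countable A"
    unfolding A_def using assms inner_subset countable_subset by blast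
  have between: "\<exists>c'\<in>A. order_iso c r c' r \<and> (cls x, c') \<in> s \<and> (c', cls z) \<in> s"
    if h: "c \<in> A" "x \<in> inner" "z \<in> inner" "sep x z" for c x z
  proof -
    obtain w where w: "w \<in> inner" "c = cls w" using h(1) by (auto simp: A_def)
    obtain y where "y \<in> inner" "sep x y" "sep y z" "order_iso (cls w) r (cls y) r"
      using inner_dense[OF w(1) h(4)] by metis
    then show ?thesis using s_iff h(2,3) w(2) by (auto simp: A_def)
  qed
  \<comment> \<open>The uncoloured case of Cantor's theorem is enough here, because the partition of
    the rationals is defined only afterwards, from the resulting bijection.\<close>
  have cd: "colour_dense A s (\<lambda>_. ())"
    unfolding colour_dense_def
  proof (intro conjI ballI impI lin)
    fix c assume "c \<in> A"
    then obtain w where w: "w \<in> inner" "c = cls w" by (auto simp: A_def)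
    obtain a b where ab: "sep a w" "sep w b" using w(1) by (auto simp: inner_def)
    obtain y where "y \<in> inner" "sep y w" using inner_dense[OF w(1) ab(1)] by blast
    then show "\<exists>w\<in>A. () = k \<and> (w, c) \<in> s" for k
      using s_iff w by (auto simp: A_def)
    obtain y where "y \<in> inner" "sep w y" using inner_dense[OF w(1) ab(2)] by blast
    then show "\<exists>w\<in>A. () = k \<and> (c, w) \<in> s" for k
      using s_iff w by (auto simp: A_def)
    fix c' assume "c' \<in> A" "(c, c') \<in> s"
    then obtain z where "z \<in> inner" "c' = cls z" "sep w z"
      using s_iff w by (auto simp: A_def)
    then show "\<exists>w\<in>A. () = k \<and> (c, w) \<in> s \<and> (w, c') \<in> s" for k
      using between[OF \<open>c \<in> A\<close> w(1)] w(2) by auto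
  qed
  have cd_rat: "colour_dense UNIV {(x, y). x < (y::rat)} (\<lambda>_. ())"
    unfolding colour_dense_def strict_linear_order_on_def
    by (auto simp: trans_def irrefl_def total_on_def lt_ex gt_ex dense)
  obtain \<phi> :: "'a set \<Rightarrow> rat" where \<phi>: "bij_betw \<phi> A UNIV"
    "\<And>c d. c \<in> A \<Longrightarrow> d \<in> A \<Longrightarrow> (c, d) \<in> s \<longleftrightarrow> \<phi> c < \<phi> d"
  proof -
    have "(\<lambda>_. ()) ` A = (\<lambda>_. ()) ` (UNIV :: rat set)" using ne by auto
    from colour_dense_iso[OF cd cnt ne cd_rat countableI_type this] that show thesis by auto
  qed
  define \<psi> where "\<psi> = inv_into A \<phi>"
  have \<psi>A: "\<psi> q \<in> A" and \<phi>\<psi>: "\<phi> (\<psi> q) = q" for q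
    using \<phi>(1) by (auto simp: \<psi>_def bij_betw_def intro: inv_into_into f_inv_into_f)
  have \<psi>\<phi>: "\<psi> (\<phi> c) = c" if "c \<in> A" for c
    using \<phi>(1) that by (simp add: \<psi>_def bij_betw_def)
  \<comment> \<open>The invariant attached to a class is the set of all classes in \<open>A\<close>
    isomorphic to it, so that equal colours will mean isomorphic classes.\<close>
  obtain N col where N: "shuffle_index N" "col ` A = N" and
    col: "\<And>c d. c \<in> A \<Longrightarrow> d \<in> A \<Longrightarrow> col c = col d \<longleftrightarrow>
      {c' \<in> A. order_iso c r c' r} = {c' \<in> A. order_iso d r c' r}"
    using countable_colouring[OF cnt ne, of "\<lambda>c. {c' \<in> A. order_iso c r c' r}"] by blast
  have col_iso: "col c = col d \<longleftrightarrow> order_iso c r d r" if cd: "c \<in> A" "d \<in> A" for c d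
  proof
    assume "col c = col d"
    then have "d \<in> {c' \<in> A. order_iso c r c' r}" using col cd order_iso_refl by blast
    then show "order_iso c r d r" by blast
  next
    assume "order_iso c r d r"
    then have "{c' \<in> A. order_iso c r c' r} = {c' \<in> A. order_iso d r c' r}"
      using order_iso_sym order_iso_trans by blast
    then show "col c = col d" using col cd by blast
  qed
  define Q where "Q k = {q. col (\<psi> q) = k}" for k
  have Q: "dense_partition N Q"
    unfolding dense_partition_def
  proof (intro conjI ballI allI impI)
    show "(\<Union>k\<in>N. Q k) = UNIV" using \<psi>A N(2) by (auto simp: Q_def)
    show "disjoint_family_on Q N" by (auto simp: disjoint_family_on_def Q_def)
    fix k and a b :: rat assume k: "k \<in> N" and ab: "a < b"
    obtain c where c: "c \<in> A" "col c = k" using k N(2) by blast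
    obtain x z where xz: "x \<in> inner" "\<psi> a = cls x" "z \<in> inner" "\<psi> b = cls z"
      using \<psi>A[of a] \<psi>A[of b] by (auto simp: A_def)
    have "(\<psi> a, \<psi> b) \<in> s" using \<phi>(2)[OF \<psi>A \<psi>A] \<phi>\<psi> ab by simp
    \<comment> \<open>Each part is dense because \<open>between\<close> finds a class of any
      occurring isomorphism type between two given ones.\<close>
    then obtain c' where c': "c' \<in> A" "order_iso c r c' r" "(\<psi> a, c') \<in> s" "(c', \<psi> b) \<in> s"
      using between[OF c(1) xz(1,3)] xz s_iff by auto
    have "a < \<phi> c'" "\<phi> c' < b"
      using c' \<phi>(2) \<psi>A \<phi>\<psi> by metis+
    moreover have "\<phi> c' \<in> Q k"
      using col_iso[OF c(1) c'(1)] c'(2) c(2) \<psi>\<phi>[OF c'(1)] by (simp add: Q_def)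
    ultimately show "\<exists>q\<in>Q k. a < q \<and> q < b" by blast
  qed
  have idx: "block_index N Q q = col (\<psi> q)" for q
    using block_index_eq[OF Q, of "col (\<psi> q)" q] \<psi>A N(2) by (auto simp: Q_def)
  \<comment> \<open>One order on natural numbers is fixed for each type; every class of that type is
    isomorphic to it through a representative \<open>c\<close>.\<close>
  have "\<exists>B t. strict_linear_order_on B t \<and> (\<forall>c\<in>A. col c = k \<longrightarrow> order_iso c r (B :: nat set) t)"
    if k: "k \<in> N" for k
  proof -
    obtain c where c: "c \<in> A" "col c = k" using k N(2) by blast
    have cX: "c \<subseteq> X" using c(1) cls_subset by (auto simp: A_def)
    then have "countable c" "strict_linear_order_on c r"
      using assms countable_subset linear
      by (auto simp: strict_linear_order_on_def intro: total_on_subset)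
    then obtain B :: "nat set" and t where B: "strict_linear_order_on B t" "order_iso c r B t"
      using countable_order_iso_nat by blast
    have "order_iso d r B t" if "d \<in> A" "col d = k" for d
      using col_iso[OF that(1) c(1)] that(2) c(2) order_iso_trans[OF _ B(2)] by simp
    then show ?thesis using B(1) by blast
  qed
  then obtain I :: "nat \<Rightarrow> nat set" and R where IR: "\<And>k. k \<in> N \<Longrightarrow> strict_linear_order_on (I k) (R k)"
    "\<And>k c. k \<in> N \<Longrightarrow> c \<in> A \<Longrightarrow> col c = k \<Longrightarrow> order_iso c r (I k) (R k)"
    by metis
  have "\<forall>c\<in>A. \<exists>f. bij_betw f c (I (col c)) \<and> (\<forall>x\<in>c. \<forall>y\<in>c. (x, y) \<in> r \<longleftrightarrow> (f x, f y) \<in> R (col c))"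
    using IR(2) N(2) unfolding order_iso_def by blast
  then obtain g where g: "\<And>c. c \<in> A \<Longrightarrow> bij_betw (g c) c (I (col c))"
    "\<And>c x y. c \<in> A \<Longrightarrow> x \<in> c \<Longrightarrow> y \<in> c \<Longrightarrow> (x, y) \<in> r \<longleftrightarrow> (g c x, g c y) \<in> R (col c)"
    by metis
  \<comment> \<open>A point is recorded by the position of its class and by its place within the
    summand that represents this class.\<close>
  define h where "h x = (\<phi> (cls x), g (cls x) x)" for x
  have clsA: "cls x \<in> A" if "x \<in> inner" for x
    using that by (simp add: A_def)
  have idx': "block_index N Q (\<phi> (cls x)) = col (cls x)" if "x \<in> inner" for x
    using idx \<psi>\<phi> clsA that by simp
  have gI: "g (cls x) x \<in> I (col (cls x))" if "x \<in> inner" for x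
    using g(1)[OF clsA[OF that]] cls_self[OF X[OF that]] by (auto dest: bij_betwE)
  have \<phi>_eq: "\<phi> (cls x) = \<phi> (cls y) \<longleftrightarrow> cls x = cls y" if "x \<in> inner" "y \<in> inner" for x y
    using \<psi>\<phi> clsA that by metis
  have "inj_on h inner"
  proof (rule inj_onI)
    fix x y assume xy: "x \<in> inner" "y \<in> inner" "h x = h y"
    then have "cls x = cls y" "g (cls x) x = g (cls x) y" using \<phi>_eq by (auto simp: h_def)
    moreover have "x \<in> cls x" "y \<in> cls y" using xy cls_self X by auto
    ultimately show "x = y"
      using g(1)[OF clsA[OF xy(1)]] by (auto simp: bij_betw_def inj_on_def)
  qed
  moreover have "h ` inner = shuffle_carrier N Q I"
  proof (intro equalityI subsetI)
    fix z assume "z \<in> h ` inner"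
    then show "z \<in> shuffle_carrier N Q I"
      using gI idx' by (auto simp: h_def shuffle_mem)
  next
    fix z assume z: "z \<in> shuffle_carrier N Q I"
    obtain q j where qj: "z = (q, j)" by fastforce
    have "j \<in> I (col (\<psi> q))" using z idx by (simp add: qj shuffle_mem)
    then obtain x where x: "x \<in> \<psi> q" "j = g (\<psi> q) x"
      using g(1)[OF \<psi>A, of q] by (auto simp: bij_betw_def)
    obtain w where w: "w \<in> inner" "\<psi> q = cls w" using \<psi>A[of q] by (auto simp: A_def)
    have xi: "x \<in> inner" using cls_inner[OF w(1)] x w by blast
    have "cls x = cls w"
      using cls_eq_iff X xi w x(1) by (auto simp: cls_def)
    then have "z = h x"
      using x(2) w(2) \<phi>\<psi>[of q] by (simp add: qj h_def)
    then show "z \<in> h ` inner" using xi by blast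
  qed
  moreover have "(x, y) \<in> r \<longleftrightarrow> (h x, h y) \<in> shuffle_rel N Q I R" if xy: "x \<in> inner" "y \<in> inner" for x y
  proof -
    have lt: "\<phi> (cls x) < \<phi> (cls y) \<longleftrightarrow> sep x y"
      using \<phi>(2) clsA xy s_iff by metis
    \<comment> \<open>This splits the order of \<open>X\<close> into the two lexicographic cases:
      different classes, compared by \<open>sep\<close>, or the same class, compared inside
      it.\<close>
    have "(x, y) \<in> r \<longleftrightarrow> sep x y \<or> cls x = cls y \<and> (x, y) \<in> r"
      using cls_eq_iff[OF X[OF xy(1)] X[OF xy(2)]] sep_less less_trans less_irrefl by blast
    also have "\<dots> \<longleftrightarrow> sep x y \<or> cls x = cls y \<and> (g (cls x) x, g (cls y) y) \<in> R (col (cls x))"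
      using g(2)[OF clsA[OF xy(1)], of x y] cls_self X xy by auto
    also have "\<dots> \<longleftrightarrow> (h x, h y) \<in> shuffle_rel N Q I R"
      using lt gI xy idx' \<phi>_eq[OF xy] by (simp add: h_def shuffle_less)
    finally show ?thesis .
  qed
  moreover have "fst (h x) \<noteq> fst (h y)" if "x \<in> inner" "y \<in> inner" "sep x y" for x y
    using \<phi>_eq[OF that(1,2)] cls_eq_iff[OF X[OF that(1)] X[OF that(2)]] that(3) by (simp add: h_def)
  ultimately show ?thesis
    using N(1) Q IR(1) unfolding bij_betw_def
    by (intro exI[of _ N] exI[of _ Q] exI[of _ I] exI[of _ R] exI[of _ h]) blast
qed

text \<open>
  A copy of \<open>X\<close> lies inside \<open>inner\<close>, so the first and the last class of \<open>X\<close>, which may be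
  truncated blocks, need no separate treatment.
\<close>

lemma iso_shuffle_interval:
  assumes "countable X"
  shows "\<exists>N Q (I :: nat \<Rightarrow> nat set) R J. shuffle_index N \<and> dense_partition N Q \<and>
    (\<forall>k\<in>N. strict_linear_order_on (I k) (R k)) \<and>
    order_interval (shuffle_carrier N Q I) (shuffle_rel N Q I R) J \<and>
    \<not> shuffle_negligible N Q I J \<and> order_iso X r J (shuffle_rel N Q I R)"
proof -
  obtain N Q h and I :: "nat \<Rightarrow> nat set" and R where
    sh: "shuffle_index N" "dense_partition N Q" "\<forall>k\<in>N. strict_linear_order_on (I k) (R k)"
    and h: "bij_betw h inner (shuffle_carrier N Q I)"
      "\<And>x y. x \<in> inner \<Longrightarrow> y \<in> inner \<Longrightarrow> (x, y) \<in> r \<longleftrightarrow> (h x, h y) \<in> shuffle_rel N Q I R"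
      "\<And>x y. x \<in> inner \<Longrightarrow> y \<in> inner \<Longrightarrow> sep x y \<Longrightarrow> fst (h x) \<noteq> fst (h y)"
    using inner_iso_shuffle[OF assms] by blast
  obtain Y a b where Y: "copy Y" "\<And>y. y \<in> Y \<Longrightarrow> sep a y \<and> sep y b"
    using copy_middle[OF copy_self] by metis
  have Yi: "Y \<subseteq> inner" using Y(2) by (auto simp: inner_def)
  obtain f where f: "bij_betw f X Y" "\<And>x y. x \<in> X \<Longrightarrow> y \<in> X \<Longrightarrow> (x, y) \<in> r \<longleftrightarrow> (f x, f y) \<in> r"
    using copy_iso[OF Y(1)] by blast
  have "order_interval inner r Y"
    using Y(1) order_interval_subset[OF _ Yi inner_subset] by (simp add: convex_copy_def)
  then have int: "order_interval (shuffle_carrier N Q I) (shuffle_rel N Q I R) (h ` Y)"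
    using order_interval_image[of h inner _ r "shuffle_rel N Q I R"] h(1,2) by blast
  have "order_iso Y r (h ` Y) (shuffle_rel N Q I R)"
    using Yi h(1,2) by (intro order_iso_image inj_on_subset[OF _ Yi]) (auto simp: bij_betw_def subset_iff)
  then have iso: "order_iso X r (h ` Y) (shuffle_rel N Q I R)"
    using Y(1) order_iso_sym order_iso_trans unfolding convex_copy_def by metis
  obtain y where y: "y \<in> Y" using copy_nonempty[OF Y(1)] by blast
  then have ay: "sep a y" using Y(2) by blast
  note mem = sep_mem[OF ay]
  \<comment> \<open>Two separated points are needed inside \<open>Y\<close> itself, so the separated
    pair \<open>a\<close>, \<open>y\<close> of \<open>X\<close> is carried there by
    \<open>f\<close>.\<close>
  have "f a \<in> Y" "f y \<in> Y" "sep (f a) (f y)"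
    using f(1) mem sep_image[OF Y(1) f mem] ay by (auto dest: bij_betwE)
  then have "fst (h (f a)) \<noteq> fst (h (f y))" "h (f a) \<in> h ` Y" "h (f y) \<in> h ` Y"
    using h(3) Yi by blast+
  then have "\<not> shuffle_negligible N Q I (h ` Y)"
    unfolding shuffle_negligible_def by (metis mem_Times_iff singletonD subsetD)
  then show ?thesis using sh int iso by blast
qed

end

text \<open>The empty order has to be excluded: it is self-similar with two empty copies, whereas an
  interval isomorphic to it is empty and hence negligible.\<close>

theorem theorem1:
  fixes X :: "'a set" and r :: "'a rel"
  assumes "strict_linear_order_on X r" and "countable X" and "X \<noteq> {}"
  shows "self_similar X r \<longleftrightarrow>
    (\<exists>(N::nat set) (Q::nat \<Rightarrow> rat set) (I::nat \<Rightarrow> nat set) (R::nat \<Rightarrow> nat rel) (J::(rat \<times> nat) set).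
       shuffle_index N \<and> dense_partition N Q \<and>
       (\<forall>k\<in>N. countable (I k) \<and> strict_linear_order_on (I k) (R k)) \<and>
       order_interval (shuffle_carrier N Q I) (shuffle_rel N Q I R) J \<and>
       \<not> shuffle_negligible N Q I J \<and>
       order_iso X r J (shuffle_rel N Q I R))"
proof
  assume "self_similar X r"
  then interpret self_similar_order X r
    using assms by unfold_locales
  show "\<exists>(N::nat set) (Q::nat \<Rightarrow> rat set) (I::nat \<Rightarrow> nat set) (R::nat \<Rightarrow> nat rel) (J::(rat \<times> nat) set).
       shuffle_index N \<and> dense_partition N Q \<and>
       (\<forall>k\<in>N. countable (I k) \<and> strict_linear_order_on (I k) (R k)) \<and>
       order_interval (shuffle_carrier N Q I) (shuffle_rel N Q I R) J \<and>
       \<not> shuffle_negligible N Q I J \<and>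
       order_iso X r J (shuffle_rel N Q I R)"
    using iso_shuffle_interval[OF assms(2)] by simp
next
  assume "\<exists>(N::nat set) (Q::nat \<Rightarrow> rat set) (I::nat \<Rightarrow> nat set) (R::nat \<Rightarrow> nat rel) (J::(rat \<times> nat) set).
       shuffle_index N \<and> dense_partition N Q \<and>
       (\<forall>k\<in>N. countable (I k) \<and> strict_linear_order_on (I k) (R k)) \<and>
       order_interval (shuffle_carrier N Q I) (shuffle_rel N Q I R) J \<and>
       \<not> shuffle_negligible N Q I J \<and>
       order_iso X r J (shuffle_rel N Q I R)"
  then show "self_similar X r"
    using shuffle_interval_self_similar self_similar_iso order_iso_sym by blast
qed

end
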